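(* Let $0<p<1$, $q=1-p$, and $h_N=\lceil Np\rceil-Np$ for $N\ge1$. Let $d_m(h;p)$, $\delta_m(p)$ and $\gamma_{m,j}(p)$ be as defined in the context, so that $d_m(h;p)=\delta_m(p)+\sum_{j=2}^{2m}\gamma_{m,j}(p)B_j(h)$. (i) If $p$ is irrational, then $(h_N)_{N\ge1}$ is equidistributed in $[0,1)$, and for every $m$ $$\lim_{M\to\infty}\frac1M\sum_{N=1}^{M}d_m(h_N;p)=\delta_m(p).$$ (ii) If $p=a/b$ with $\gcd(a,b)=1$, then $h_N$ is periodic in $N$ with period $b$ and takes each of the values $0,\tfrac1b,\dots,\tfrac{b-1}b$ exactly once per period. Consequently the mean of $d_m(h_N;p)$ over a period is obtained from the decomposition of $d_m$ by the substitution $B_j(h)\mapsto b^{-j}B_j$, that is, it equals $$\delta_m(p)+\sum_{j=2}^{2m}\gamma_{m,j}(p)\,b^{-j}B_j.$$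
   Context: $B_k(t)$ are the Bernoulli polynomials, $\frac{z e^{tz}}{e^z-1}=\sum_{k\ge0}B_k(t)\frac{z^k}{k!}$, and $B_k=B_k(0)$ the Bernoulli numbers. For $k\ge1$ define $$a_k(h;p)=\frac{(-1)^{k+1}}{k(k+1)}\Bigl[B_{k+1}-\bigl(p^{-k}+(-1)^{k+1}q^{-k}\bigr)B_{k+1}(h)\Bigr],$$ and define $d_m(h;p)$ by $d_0=1$ and $d_m(h;p)=\frac1m\sum_{k=1}^{m}k\,a_k(h;p)\,d_{m-k}(h;p)$ for $m\ge1$. (These are the coefficients in the expansion $\mathbb E|X-Np|\sim\sqrt{2Npq/\pi}\,\sum_{m\ge0}d_m(h_N;p)N^{-m}$ for $X\sim\operatorname{Bin}(N,p)$.) For fixed $p$, $d_m(h;p)$ is a polynomial in $h$ of degree at most $2m$, and its expansion in the basis $\{B_j(h)\}_{j\ge0}$ of polynomials contains no $B_1$-term; it is written $$d_m(h;p)=\delta_m(p)+\sum_{j=2}^{2m}\gamma_{m,j}(p)\,B_j(h),$$ which defines the smooth part $\delta_m(p)$ (the coefficient of $B_0=1$) and the coefficients $\gamma_{m,j}(p)$ of the lattice part. *)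

theory Defs
  imports "HOL-Analysis.Analysis" "HOL-Computational_Algebra.Computational_Algebra"
begin

text \<open>
  The Bernoulli polynomials, as elements of the polynomial ring \<open>\<real>[t]\<close>: the generating function
  \<open>(z / (exp z - 1)) \<cdot> exp (t z)\<close> is formed in \<open>\<real>[t][[z]]\<close>, with \<open>z\<close> the variable of the
  power series and \<open>t\<close> the variable of the polynomials.
\<close>

definition bernpoly_egf :: "real poly fps" where
  "bernpoly_egf =
     Abs_fps (\<lambda>n. [:fps_nth (fps_X / (fps_exp 1 - 1)) n:]) * Abs_fps (\<lambda>n. monom (1 / fact n) n)"

definition bernpoly :: "nat \<Rightarrow> real poly" where
  "bernpoly k = smult (fact k) (fps_nth bernpoly_egf k)"

definition bernoulli :: "nat \<Rightarrow> real" where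
  "bernoulli k = poly (bernpoly k) 0"

text \<open>The familiar form of the generating function, at each real \<open>t\<close>.\<close>

lemma bernpoly_generating_function:
  "Abs_fps (\<lambda>k. poly (bernpoly k) t / fact k) = fps_X * fps_exp t / (fps_exp (1::real) - 1)"
proof -
  define g :: "real fps" where "g = fps_exp 1 - 1"
  have "fps_nth g 0 = 0" "fps_nth g 1 = 1" by (simp_all add: g_def)
  hence sd: "subdegree g = 1" by (intro subdegreeI) auto
  hence "g \<noteq> 0" by auto
  with sd have "g dvd fps_X" by (simp add: fps_dvd_iff fps_X_neq_zero)
  hence "fps_X * fps_exp t / g = fps_X / g * fps_exp t"
    by (simp add: dvd_div_mult)
  moreover have "Abs_fps (\<lambda>k. poly (bernpoly k) t / fact k) = fps_X / g * fps_exp t"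
    by (rule fps_ext)
       (simp add: bernpoly_def bernpoly_egf_def fps_mult_nth poly_sum poly_monom g_def)
  ultimately show ?thesis by (simp add: g_def)
qed

text \<open>\<open>a_k(h;p)\<close> and \<open>d_m(h;p)\<close> for fixed \<open>p\<close>, as polynomials in \<open>h\<close>; here \<open>q = 1 - p\<close>.\<close>

definition a_poly :: "real \<Rightarrow> nat \<Rightarrow> real poly" where
  "a_poly p k =
     smult ((-1) ^ (k + 1) / (real k * real (k + 1)))
       ([:bernoulli (k + 1):]
          - smult (1 / p ^ k + (-1) ^ (k + 1) * (1 / (1 - p) ^ k)) (bernpoly (k + 1)))"

fun d_poly :: "real \<Rightarrow> nat \<Rightarrow> real poly" where
  "d_poly p m =
     (if m = 0 then 1
      else smult (1 / real m) (\<Sum>k = 1..m. smult (real k) (a_poly p k * d_poly p (m - k))))"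

declare d_poly.simps [simp del]

text \<open>
  Coordinates of a polynomial in the basis \<open>(B_j)\<close> of the real vector space \<open>\<real>[h]\<close>, whose scalar
  multiplication is \<^const>\<open>smult\<close>.
\<close>

definition bern_coeff :: "real poly \<Rightarrow> nat \<Rightarrow> real" where
  "bern_coeff P j = module.representation smult (range bernpoly) P (bernpoly j)"

definition smooth_part :: "real \<Rightarrow> nat \<Rightarrow> real" where
  "smooth_part p m = bern_coeff (d_poly p m) 0"

definition lattice_coeff :: "real \<Rightarrow> nat \<Rightarrow> nat \<Rightarrow> real" where
  "lattice_coeff p m j = bern_coeff (d_poly p m) j"

definition h_seq :: "real \<Rightarrow> nat \<Rightarrow> real" where
  "h_seq p N = of_int \<lceil>real N * p\<rceil> - real N * p"

text \<open>Sequences are indexed from 1; the value at 0 is ignored.\<close>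

definition equidistributed01 :: "(nat \<Rightarrow> real) \<Rightarrow> bool" where
  "equidistributed01 x \<longleftrightarrow>
     (\<forall>N\<ge>1. x N \<in> {0..<1}) \<and>
     (\<forall>u v. 0 \<le> u \<and> u \<le> v \<and> v \<le> 1 \<longrightarrow>
        (\<lambda>M. real (card {N \<in> {1..M}. x N \<in> {u..<v}}) / real M) \<longlonglongrightarrow> v - u)"

end

theory Submission
  imports Defs "HOL-Analysis.Kronecker_Approximation_Theorem"
begin

text \<open>The coefficient of \<open>B\<^sub>1\<close> in a polynomial \<open>P\<close> is \<open>P(1) - P(0)\<close>, and it vanishes for \<open>d\<^sub>m\<close> because
  \<open>B\<^sub>k(1) = B\<^sub>k(0)\<close> for \<open>k \<ge> 2\<close>. The mean of \<open>P\<close> over the grid \<open>i/n\<close>, \<open>i < n\<close>, is given by Raabe's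
  multiplication theorem, which replaces \<open>B\<^sub>j\<close> by \<open>n\<^sup>-\<^sup>j B\<^sub>j(0)\<close>. For \<open>p = a/b\<close> one period of \<open>h\<close> runs through
  exactly this grid with \<open>n = b\<close>. For irrational \<open>p\<close> the orbit means converge to the limit of the grid
  means as \<open>n \<rightarrow> \<infinity>\<close>, that is, to the coefficient of \<open>B\<^sub>0\<close>.\<close>

subsection \<open>Bernoulli polynomials\<close>

definition bernpoly_series :: "real \<Rightarrow> real fps" where
  "bernpoly_series t = Abs_fps (\<lambda>k. poly (bernpoly k) t / fact k)"

lemma fps_exp_minus_one_nonzero: "fps_exp c - 1 \<noteq> 0" if "c \<noteq> (0::real)"
proof
  assume "fps_exp c - 1 = 0"
  hence "fps_nth (fps_exp c - 1) 1 = 0" by simp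
  with that show False by simp
qed

text \<open>The quotient in \<open>bernpoly_generating_function\<close> is exact, since
  \<open>fps_exp 1 - 1\<close> has subdegree 1 and so divides \<open>fps_X\<close>. With the
  denominator cleared, later identities follow by cancelling nonzero series.\<close>

lemma bernpoly_series_times: "bernpoly_series t * (fps_exp 1 - 1) = fps_X * fps_exp t"
proof -
  define g :: "real fps" where "g = fps_exp 1 - 1"
  have "fps_nth g 0 = 0" "fps_nth g 1 = 1" by (simp_all add: g_def)
  hence sd: "subdegree g = 1" by (intro subdegreeI) auto
  hence "g \<noteq> 0" by auto
  with sd have "g dvd fps_X" by (simp add: fps_dvd_iff fps_X_neq_zero)
  hence "g dvd fps_X * fps_exp t" by simp
  thus ?thesis
    by (simp add: bernpoly_series_def bernpoly_generating_function g_def)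
qed

text \<open>The generating functions at 1 and 0 differ by
  \<open>z (exp z - 1) / (exp z - 1) = z\<close>.\<close>

lemma bernpoly_1_minus_0: "poly (bernpoly k) 1 - poly (bernpoly k) 0 = (if k = 1 then 1 else 0)"
proof -
  have "(bernpoly_series 1 - bernpoly_series 0) * (fps_exp 1 - 1) = fps_X * (fps_exp 1 - 1)"
    unfolding left_diff_distrib bernpoly_series_times by (simp add: right_diff_distrib)
  hence "bernpoly_series 1 - bernpoly_series 0 = fps_X"
    using fps_exp_minus_one_nonzero[of 1] by simp
  hence "fps_nth (bernpoly_series 1 - bernpoly_series 0) k = fps_nth fps_X k"
    by simp
  thus ?thesis by (auto simp: bernpoly_series_def field_simps split: if_splits)
qed

text \<open>Both sides have generating function \<open>z / (exp (z / b) - 1)\<close>, because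
  \<open>\<Sum>i<b. exp (i z / b)\<close> is a geometric sum.\<close>

lemma bernpoly_multiplication:
  assumes "b > 0"
  shows "(\<Sum>i<b. poly (bernpoly j) (real i / real b)) = real b * (1 / real b ^ j) * bernoulli j"
proof -
  define c where "c = 1 / real b"
  have c: "c \<noteq> 0" using assms by (simp add: c_def)
  define S where "S = (\<Sum>i<b. bernpoly_series (real i * c))"
  define H where "H = bernpoly_series 0 oo (fps_const c * fps_X)"
  have "(\<Sum>i<b. fps_exp (real i * c)) * (fps_exp c - 1) = fps_exp 1 - (1 :: real fps)"
  proof -
    have "(\<Sum>i<b. fps_exp (real i * c)) = (\<Sum>i<b. fps_exp c ^ i)"
      by (simp add: fps_exp_power_mult)
    also have "\<dots> * (fps_exp c - 1) = fps_exp c ^ b - 1"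
      using power_diff_1_eq[of "fps_exp c" b] by (simp add: mult.commute)
    also have "fps_exp c ^ b = fps_exp 1" using assms by (simp add: fps_exp_power_mult c_def)
    finally show ?thesis .
  qed
  moreover have "S * (fps_exp 1 - 1) = fps_X * (\<Sum>i<b. fps_exp (real i * c))"
    unfolding S_def by (simp add: sum_distrib_right sum_distrib_left bernpoly_series_times)
  \<comment> \<open>Grouped the other way, this product is \<open>z\<close> times the geometric sum
    times \<open>fps_exp c - 1\<close>, that is, \<open>z (exp z - 1)\<close>, so
    \<open>exp z - 1\<close> cancels.\<close>
  moreover have "(S * (fps_exp c - 1)) * (fps_exp 1 - 1) = (S * (fps_exp 1 - 1)) * (fps_exp c - 1)"
    by (simp only: mult_ac)
  ultimately have "(S * (fps_exp c - 1)) * (fps_exp 1 - 1) = fps_X * (fps_exp 1 - 1)"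
    by (simp only: mult.assoc)
  hence S: "S * (fps_exp c - 1) = fps_X"
    using fps_exp_minus_one_nonzero[of 1] by simp
  \<comment> \<open>Substituting \<open>c z\<close> for \<open>z\<close> in
    \<open>bernpoly_series_times\<close> at \<open>t = 0\<close> gives \<open>H\<close> times
    \<open>fps_exp c - 1\<close> equal to \<open>c z\<close>, the same product as for
    \<open>c S\<close>.\<close>
  have "H * ((fps_exp 1 - 1) oo (fps_const c * fps_X)) = fps_X oo (fps_const c * fps_X)"
    unfolding H_def
    by (subst fps_compose_mult_distrib[symmetric]) (simp_all add: bernpoly_series_times)
  hence "H * (fps_exp c - 1) = fps_const c * fps_X"
    by (simp add: fps_compose_sub_distrib)
  with S have "(fps_const c * S - H) * (fps_exp c - 1) = 0"
    by (simp add: left_diff_distrib mult.assoc)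
  hence "fps_const c * S = H"
    using fps_exp_minus_one_nonzero[OF c] by simp
  hence "fps_nth (fps_const c * S) j = fps_nth H j" by simp
  hence "c * (\<Sum>i<b. poly (bernpoly j) (real i * c) / fact j) = c ^ j * (bernoulli j / fact j)"
    by (simp add: S_def H_def fps_sum_nth bernpoly_series_def bernoulli_def)
  hence "c * (\<Sum>i<b. poly (bernpoly j) (real i * c)) = c ^ j * bernoulli j"
    by (simp add: sum_divide_distrib[symmetric])
  thus ?thesis using assms by (simp add: c_def field_simps)
qed

section \<open>Coefficients and degrees of the Bernoulli polynomials\<close>

text \<open>In the Cauchy product only the term \<open>l = k - i\<close> carries the power
  \<open>t^i\<close>.\<close>

lemma coeff_bernpoly:
  "coeff (bernpoly k) i =
     (if i \<le> k then fact k * fps_nth (fps_X / (fps_exp 1 - 1)) (k - i) / fact i else 0)"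
proof -
  define g :: "nat \<Rightarrow> real" where "g = fps_nth (fps_X / (fps_exp 1 - 1))"
  have "coeff (bernpoly k) i =
      fact k * (\<Sum>l = 0..k. g l * (if k - l = i then 1 / fact (k - l) else 0))"
    by (simp add: bernpoly_def bernpoly_egf_def fps_mult_nth coeff_sum g_def)
  also have "(\<Sum>l = 0..k. g l * (if k - l = i then 1 / fact (k - l) else 0)) =
      (\<Sum>l = 0..k. if l = k - i then (if i \<le> k then g l / fact i else 0) else 0)"
    by (intro sum.cong) auto
  also have "\<dots> = (if i \<le> k then g (k - i) / fact i else 0)"
    by (subst sum.delta) auto
  finally show ?thesis by (simp add: g_def)
qed

text \<open>For every \<open>k\<close> the leading coefficient is the constant term of
  \<open>z / (exp z - 1)\<close>, so its value can be found at \<open>k = 0\<close>.\<close>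

lemma lead_coeff_bernpoly: "coeff (bernpoly k) k = 1"
proof -
  have "poly (bernpoly 0) 0 = 1"
  proof -
    have "fps_nth (bernpoly_series 0 * (fps_exp 1 - 1)) 1 = 1"
      by (simp add: bernpoly_series_times)
    thus ?thesis by (simp add: fps_mult_nth bernpoly_series_def)
  qed
  hence "coeff (bernpoly 0) 0 = 1" by (simp add: poly_0_coeff_0)
  hence g: "fps_nth (fps_X / (fps_exp 1 - 1)) 0 = (1 :: real)"
    unfolding coeff_bernpoly by simp
  show ?thesis unfolding coeff_bernpoly diff_self_eq_0 g by simp
qed

lemma degree_bernpoly: "degree (bernpoly k) = k"
proof (rule antisym)
  show "degree (bernpoly k) \<le> k" by (rule degree_le) (simp add: coeff_bernpoly)
  show "k \<le> degree (bernpoly k)" by (rule le_degree) (simp add: lead_coeff_bernpoly)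
qed

lemma bernpoly_0: "bernpoly 0 = 1"
proof -
  obtain a where a: "bernpoly 0 = [:a:]" using degree_bernpoly[of 0] by (rule degree_eq_zeroE)
  with lead_coeff_bernpoly[of 0] show ?thesis by (simp add: one_pCons)
qed

section \<open>Coordinates in the Bernoulli basis\<close>

lemma inj_bernpoly: "inj bernpoly"
  by (metis degree_bernpoly injI)

text \<open>Since \<open>bernpoly (Suc n)\<close> is monic of degree \<open>Suc n\<close>,
  subtracting a multiple of it removes the top coefficient of \<open>P\<close>, and induction
  applies to the rest.\<close>

lemma bernpoly_expansion_exists:
  "degree P \<le> n \<Longrightarrow> \<exists>c. P = (\<Sum>j\<le>n. smult (c j) (bernpoly j))"
proof (induction n arbitrary: P)
  case 0
  then obtain a where "P = [:a:]" by (metis degree_eq_zeroE le_zero_eq)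
  thus ?case by (auto simp: bernpoly_0)
next
  case (Suc n)
  define Q where "Q = P - smult (coeff P (Suc n)) (bernpoly (Suc n))"
  have "degree Q \<le> n"
  proof (rule degree_le, intro allI impI)
    fix i assume "i > n"
    show "coeff Q i = 0"
    proof (cases "i = Suc n")
      case True
      thus ?thesis by (simp add: Q_def lead_coeff_bernpoly)
    next
      case False
      with \<open>i > n\<close> have "coeff P i = 0" "coeff (bernpoly (Suc n)) i = 0"
        using Suc.prems by (auto intro!: coeff_eq_0 simp: degree_bernpoly)
      thus ?thesis by (simp add: Q_def)
    qed
  qed
  then obtain c where c: "Q = (\<Sum>j\<le>n. smult (c j) (bernpoly j))" using Suc.IH by blast
  define c' where "c' = c(Suc n := coeff P (Suc n))"
  have "(\<Sum>j\<le>Suc n. smult (c' j) (bernpoly j)) = Q + smult (coeff P (Suc n)) (bernpoly (Suc n))"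
    unfolding c by (simp add: c'_def)
  hence "P = (\<Sum>j\<le>Suc n. smult (c' j) (bernpoly j))" by (simp add: Q_def)
  thus ?case by blast
qed

interpretation poly_vs: vector_space "smult :: real \<Rightarrow> real poly \<Rightarrow> real poly"
  by unfold_locales (simp_all add: smult_add_right smult_add_left)

text \<open>Distinct Bernoulli polynomials have distinct degrees. In a vanishing combination, the
  one of largest degree among those with nonzero coefficient is alone in contributing at that
  degree.\<close>

lemma independent_bernpoly: "poly_vs.independent (range bernpoly)"
  unfolding poly_vs.independent_explicit_module
proof (intro allI impI)
  fix t u v
  assume t: "finite t" "t \<subseteq> range bernpoly" and z: "(\<Sum>v\<in>t. smult (u v) v) = 0" and v: "v \<in> t"
  show "u v = 0"
  proof (rule ccontr)
    assume "u v \<noteq> 0"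
    define W where "W = {w \<in> t. u w \<noteq> 0}"
    have W: "finite W" "W \<noteq> {}" using t v \<open>u v \<noteq> 0\<close> by (auto simp: W_def)
    \<comment> \<open>Minimising the negated degree picks an element of largest degree.\<close>
    define w where "w = arg_min_on (\<lambda>w. - int (degree w)) W"
    have w: "w \<in> W" "\<And>x. x \<in> W \<Longrightarrow> degree x \<le> degree w"
      using arg_min_if_finite[OF W, of "\<lambda>w. - int (degree w)"]
      by (auto simp: w_def not_less[symmetric])
    have "0 = coeff (\<Sum>v\<in>t. smult (u v) v) (degree w)" by (simp add: z)
    also have "\<dots> = (\<Sum>v\<in>t. u v * coeff v (degree w))" by (simp add: coeff_sum)
    also have "\<dots> = (\<Sum>v\<in>{w}. u v * coeff v (degree w))"
    proof (rule sum.mono_neutral_right[OF t(1)])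
      show "{w} \<subseteq> t" using w by (auto simp: W_def)
      show "\<forall>i\<in>t - {w}. u i * coeff i (degree w) = 0"
      proof
        fix x assume x: "x \<in> t - {w}"
        show "u x * coeff x (degree w) = 0"
        proof (cases "u x = 0")
          case False
          with x have "x \<in> W" by (simp add: W_def)
          moreover obtain a b where "x = bernpoly a" "w = bernpoly b"
            using t(2) x w(1) unfolding W_def by blast
          ultimately have "degree x < degree w"
            using w(2)[of x] x by (auto simp: degree_bernpoly le_less)
          thus ?thesis by (simp add: coeff_eq_0)
        qed simp
      qed
    qed
    also have "\<dots> = u w"
    proof -
      obtain b where "w = bernpoly b" using t w(1) by (auto simp: W_def)
      thus ?thesis by (simp add: degree_bernpoly lead_coeff_bernpoly)
    qed
    finally show False using w(1) by (simp add: W_def)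
  qed
qed

text \<open>Independence makes coordinates readable off any expansion. As
  \<open>representation\<close> is indexed by basis elements, \<open>inj_bernpoly\<close> translates
  back to indices.\<close>

lemma bern_coeff_sum:
  "bern_coeff (\<Sum>j\<le>n. smult (c j) (bernpoly j)) i = (if i \<le> n then c i else 0)"
proof -
  have span: "bernpoly j \<in> poly_vs.span (range bernpoly)" for j
    by (rule poly_vs.span_base) simp
  have "bern_coeff (\<Sum>j\<le>n. smult (c j) (bernpoly j)) i
      = (\<Sum>j\<le>n. c j * (if i = j then 1 else 0))"
    unfolding bern_coeff_def
    by (simp add: poly_vs.representation_sum poly_vs.representation_scale poly_vs.representation_basis
        independent_bernpoly span poly_vs.span_scale inj_eq[OF inj_bernpoly])
  also have "\<dots> = (\<Sum>j\<le>n. if i = j then c j else 0)" by (intro sum.cong) auto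
  also have "\<dots> = (if i \<le> n then c i else 0)" by (subst sum.delta') auto
  finally show ?thesis .
qed

lemma bernpoly_expansion:
  assumes "degree P \<le> n"
  shows "P = (\<Sum>j\<le>n. smult (bern_coeff P j) (bernpoly j))"
proof -
  obtain c where c: "P = (\<Sum>j\<le>n. smult (c j) (bernpoly j))"
    using bernpoly_expansion_exists[OF assms] by blast
  have "\<And>j. j \<le> n \<Longrightarrow> bern_coeff P j = c j" unfolding c by (simp add: bern_coeff_sum)
  thus ?thesis by (subst c) (intro sum.cong, auto)
qed

text \<open>The functional \<open>P(1) - P(0)\<close> is 1 on \<open>bernpoly 1\<close> and 0 on all
  other \<open>bernpoly j\<close>, so it is the coordinate functional of
  \<open>bernpoly 1\<close>.\<close>

lemma bern_coeff_1:
  assumes "degree P \<le> n" "n > 0"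
  shows "bern_coeff P 1 = poly P 1 - poly P 0"
proof -
  have "poly P 1 - poly P 0 =
      (\<Sum>j\<le>n. bern_coeff P j * (poly (bernpoly j) 1 - poly (bernpoly j) 0))"
    by (subst (1 2) bernpoly_expansion[OF assms(1)])
       (simp add: poly_sum sum_subtractf[symmetric] right_diff_distrib)
  also have "\<dots> = (\<Sum>j\<le>n. if j = 1 then bern_coeff P j else 0)"
    by (intro sum.cong) (auto simp: bernpoly_1_minus_0)
  also have "\<dots> = bern_coeff P 1" using assms(2) by simp
  finally show ?thesis by simp
qed

lemma poly_bernpoly_expansion_without_linear:
  assumes "degree P \<le> n" "poly P 1 = poly P 0"
  shows "poly P h = bern_coeff P 0 + (\<Sum>j = 2..n. bern_coeff P j * poly (bernpoly j) h)"
proof -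
  \<comment> \<open>The degree bound is raised by one so that index 1 is in range even for
    \<open>n = 0\<close>; the extra coordinate \<open>m\<close> vanishes.\<close>
  define m where "m = Suc n"
  have deg: "degree P \<le> m" using assms(1) by (simp add: m_def)
  have top: "bern_coeff P m = 0"
  proof -
    obtain c where c: "P = (\<Sum>j\<le>n. smult (c j) (bernpoly j))"
      using bernpoly_expansion_exists[OF assms(1)] by blast
    show ?thesis unfolding c m_def by (simp add: bern_coeff_sum)
  qed
  have one: "bern_coeff P 1 = 0"
    using bern_coeff_1[OF deg] assms(2) by (simp add: m_def)
  define f where "f = (\<lambda>j. bern_coeff P j * poly (bernpoly j) h)"
  have "poly P h = (\<Sum>j\<le>m. f j)"
    by (subst bernpoly_expansion[OF deg]) (simp add: poly_sum f_def)
  also have "\<dots> = (\<Sum>j\<in>insert 0 {2..n}. f j)"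
  proof (rule sum.mono_neutral_right)
    show "insert 0 {2..n} \<subseteq> {..m}" by (auto simp: m_def)
    show "\<forall>j\<in>{..m} - insert 0 {2..n}. f j = 0"
    proof
      fix j assume "j \<in> {..m} - insert 0 {2..n}"
      hence "j = 1 \<or> j = m" by (auto simp: m_def)
      thus "f j = 0" using top one by (auto simp: f_def)
    qed
  qed simp
  also have "\<dots> = f 0 + (\<Sum>j = 2..n. f j)" by simp
  finally show ?thesis by (simp add: f_def bernpoly_0)
qed

section \<open>Decomposition and grid means of \<open>d_poly\<close>\<close>

lemma degree_a_poly: "degree (a_poly p k) \<le> k + 1"
  unfolding a_poly_def
  by (intro order.trans[OF degree_smult_le] degree_diff_le) (auto simp: degree_bernpoly)

lemma degree_d_poly: "degree (d_poly p m) \<le> 2 * m"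
proof (induction m rule: less_induct)
  case (less m)
  show ?case
  proof (cases "m = 0")
    case True
    thus ?thesis by (simp add: d_poly.simps)
  next
    case False
    have "degree (smult (real k) (a_poly p k * d_poly p (m - k))) \<le> 2 * m" if "k \<in> {1..m}" for k
    proof -
      have "degree (smult (real k) (a_poly p k * d_poly p (m - k)))
          \<le> degree (a_poly p k) + degree (d_poly p (m - k))"
        by (meson degree_smult_le degree_mult_le order.trans)
      also have "\<dots> \<le> (k + 1) + 2 * (m - k)"
        using that by (intro add_mono degree_a_poly less.IH) auto
      \<comment> \<open>The left side is \<open>2 * m + 1 - k\<close>, and
        \<open>k \<ge> 1\<close>.\<close>
      also have "\<dots> \<le> 2 * m" using that by auto
      finally show ?thesis .
    qed
    hence "degree (\<Sum>k = 1..m. smult (real k) (a_poly p k * d_poly p (m - k))) \<le> 2 * m"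
      by (intro degree_sum_le) auto
    thus ?thesis using False
      by (subst d_poly.simps) (auto intro: order.trans[OF degree_smult_le])
  qed
qed

lemma poly_a_poly_1: "k \<ge> 1 \<Longrightarrow> poly (a_poly p k) 1 = poly (a_poly p k) 0"
  using bernpoly_1_minus_0[of "k + 1"] by (simp add: a_poly_def)

text \<open>Taking equal values at 0 and 1 is preserved by sums, products and scaling, so it passes
  from the \<open>a_poly p k\<close> through the recursion. This is what rules out a term in
  \<open>bernpoly 1\<close>.\<close>

lemma poly_d_poly_1: "poly (d_poly p m) 1 = poly (d_poly p m) 0"
proof (induction m rule: less_induct)
  case (less m)
  show ?case
    by (subst (1 2) d_poly.simps) (auto simp: poly_sum less.IH poly_a_poly_1 intro!: sum.cong)
qed

lemma d_poly_decomposition: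
  "poly (d_poly p m) h
     = smooth_part p m + (\<Sum>j = 2..2 * m. lattice_coeff p m j * poly (bernpoly j) h)"
  unfolding smooth_part_def lattice_coeff_def
  by (rule poly_bernpoly_expansion_without_linear[OF degree_d_poly poly_d_poly_1])

text \<open>Raabe's theorem applied termwise. It serves both cases: as an exact period mean for
  rational \<open>p\<close>, and in the limit of fine grids for irrational \<open>p\<close>.\<close>

lemma d_poly_grid_mean:
  assumes "b > 0"
  shows "1 / real b * (\<Sum>i<b. poly (d_poly p m) (real i / real b))
     = smooth_part p m + (\<Sum>j = 2..2 * m. lattice_coeff p m j * (1 / real b ^ j) * bernoulli j)"
proof -
  have "(\<Sum>i<b. poly (d_poly p m) (real i / real b)) = real b * smooth_part p m
      + (\<Sum>j = 2..2 * m. lattice_coeff p m j * (\<Sum>i<b. poly (bernpoly j) (real i / real b)))"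
    unfolding d_poly_decomposition
    by (simp add: sum.distrib sum_distrib_left) (rule sum.swap)
  also have "\<dots> = real b * (smooth_part p m
      + (\<Sum>j = 2..2 * m. lattice_coeff p m j * (1 / real b ^ j) * bernoulli j))"
    unfolding bernpoly_multiplication[OF assms]
    by (simp add: distrib_left sum_distrib_left mult_ac)
  finally show ?thesis using assms by simp
qed

subsection \<open>Equidistribution\<close>

lemma h_seq_bounds: "0 \<le> h_seq p N" "h_seq p N < 1"
  unfolding h_seq_def by linarith+

text \<open>The sets \<open>T i\<close> are disjoint parts of \<open>{1..M}\<close>, so their sizes
  add up to at most \<open>M\<close>. Shifting back by \<open>k i\<close> loses only the elements of
  \<open>A\<close> up to \<open>k i\<close>.\<close>

lemma card_times_le_if_disjoint_translates:
  fixes A :: "nat set" and k :: "nat \<Rightarrow> nat"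
  assumes "\<And>i j N. i < n \<Longrightarrow> j < n \<Longrightarrow> N + k i \<in> A \<Longrightarrow> N + k j \<in> A \<Longrightarrow> i = j"
  shows "n * card (A \<inter> {1..M}) \<le> M + (\<Sum>i<n. k i)"
proof -
  define T where "T = (\<lambda>i. {N \<in> {1..M}. N + k i \<in> A})"
  have "card (A \<inter> {1..M}) \<le> card (T i) + k i" for i
  proof -
    have "A \<inter> {1..M} \<subseteq> (\<lambda>N. N + k i) ` T i \<union> {1..k i}"
    proof
      fix x assume x: "x \<in> A \<inter> {1..M}"
      show "x \<in> (\<lambda>N. N + k i) ` T i \<union> {1..k i}"
      proof (cases "x \<le> k i")
        case False
        with x have "x - k i \<in> T i" "x = (x - k i) + k i" by (auto simp: T_def)
        thus ?thesis by blast
      qed (use x in auto)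
    qed
    hence "card (A \<inter> {1..M}) \<le> card ((\<lambda>N. N + k i) ` T i \<union> {1..k i})"
      by (intro card_mono) (auto simp: T_def)
    also have "\<dots> \<le> card ((\<lambda>N. N + k i) ` T i) + card {1..k i}" by (rule card_Un_le)
    also have "\<dots> \<le> card (T i) + k i"
      using card_image_le[of "T i" "\<lambda>N. N + k i"] by (simp add: T_def)
    finally show ?thesis .
  qed
  hence "(\<Sum>i<n. card (A \<inter> {1..M})) \<le> (\<Sum>i<n. card (T i) + k i)" by (intro sum_mono) auto
  hence "n * card (A \<inter> {1..M}) \<le> (\<Sum>i<n. card (T i)) + (\<Sum>i<n. k i)"
    by (simp add: sum.distrib)
  also have "(\<Sum>i<n. card (T i)) = card (\<Union>i<n. T i)"
    by (rule card_UN_disjoint[symmetric]) (use assms in \<open>auto simp: T_def\<close>)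
  also have "\<dots> \<le> card {1..M}" by (intro card_mono) (auto simp: T_def)
  finally show ?thesis by simp
qed

text \<open>Short arcs are visited with frequency at most \<open>1 / n\<close>: by density of the rotation,
  \<open>n\<close> of its translates along the orbit fit disjointly into the circle.\<close>

lemma card_visits_short_arc:
  fixes p :: real
  assumes "p \<notin> \<rat>" "n > 0" "l < 1 / real n"
  shows "\<exists>C. \<forall>M. n * card ({N. frac (- real N * p - u) < l} \<inter> {1..M}) \<le> M + C"
proof -
  \<comment> \<open>Half the slack: if \<open>frac (k p)\<close> is within \<open>e\<close> of
    \<open>i/n + e\<close>, the arc of length \<open>l\<close> starting there stays inside the
    window from \<open>i/n\<close> to \<open>(i+1)/n\<close>.\<close>
  define e where "e = (1 / real n - l) / 2"
  have e: "e > 0" using assms by (simp add: e_def)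
  have "\<exists>k. \<bar>frac (real k * p) - t\<bar> < e" if "0 \<le> t" "t \<le> 1" for t
    using Kronecker_approx_1_explicit[OF assms(1) that e] by metis
  moreover have l: "l = 1 / real n - 2 * e" by (simp add: e_def field_simps)
  ultimately have "\<exists>k. real i / real n \<le> frac (real k * p) \<and> frac (real k * p) + l < (real i + 1) / real n"
    if "i < n" "l \<ge> 0" for i
  proof -
    have "real i / real n + e \<le> (real i + 1) / real n"
      using that e l by (simp add: add_divide_distrib)
    also have "\<dots> \<le> 1" using that by (simp add: divide_le_eq)
    finally have "real i / real n + e \<le> 1" .
    then obtain k where "\<bar>frac (real k * p) - (real i / real n + e)\<bar> < e"
      using \<open>\<And>t. 0 \<le> t \<Longrightarrow> t \<le> 1 \<Longrightarrow> \<exists>k. \<bar>frac (real k * p) - t\<bar> < e\<close> e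
      by (metis add_nonneg_nonneg divide_nonneg_nonneg less_imp_le of_nat_0_le_iff)
    hence "real i / real n \<le> frac (real k * p)" "frac (real k * p) + l < real i / real n + 1 / real n"
      using l by linarith+
    thus ?thesis by (auto simp: add_divide_distrib)
  qed
  hence "\<exists>k. \<forall>i. i < n \<and> l \<ge> 0 \<longrightarrow>
      real i / real n \<le> frac (real (k i) * p) \<and> frac (real (k i) * p) + l < (real i + 1) / real n"
    by metis
  then obtain k where k: "real i / real n \<le> frac (real (k i) * p)"
      "frac (real (k i) * p) + l < (real i + 1) / real n" if "i < n" "l \<ge> 0" for i
    by blast
  define A where "A = {N. frac (- real N * p - u) < l}"
  \<comment> \<open>Advancing by \<open>k i\<close> rotates by minus \<open>frac (k i * p)\<close>.
    Hence landing in the arc at \<open>N + k i\<close> forces the point at \<open>N\<close> into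
    window \<open>i\<close>, and the windows are disjoint.\<close>
  have window: "real i / real n \<le> frac (- real N * p - u) \<and> frac (- real N * p - u) < (real i + 1) / real n"
    if "i < n" "N + k i \<in> A" for i N
  proof -
    define y where "y = frac (- real N * p - u)"
    define t where "t = frac (real (k i) * p)"
    have "frac (- real (N + k i) * p - u) < l" using that by (simp only: A_def mem_Collect_eq)
    moreover have "0 \<le> frac (- real (N + k i) * p - u)" by simp
    \<comment> \<open>For negative \<open>l\<close> the set \<open>A\<close> is empty; a member of
      \<open>A\<close> thus unlocks the guarded bounds on \<open>k\<close>.\<close>
    ultimately have l0: "l \<ge> 0" by linarith
    have "- real (N + k i) * p - u = y - t
        + of_int (\<lfloor>- real N * p - u\<rfloor> - \<lfloor>real (k i) * p\<rfloor>)"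
      by (simp add: y_def t_def frac_def algebra_simps)
    hence "frac (- real (N + k i) * p - u) = frac (y - t)"
      by (metis frac_add_of_int_right)
    with \<open>frac (- real (N + k i) * p - u) < l\<close> have f: "frac (y - t) < l" by simp
    have y: "0 \<le> y" "y < 1" by (simp_all add: y_def frac_lt_1)
    have t: "real i / real n \<le> t" "t + l < (real i + 1) / real n"
      using k[OF that(1) l0] by (simp_all add: t_def)
    have "(real i + 1) / real n \<le> 1" using that(1) by (simp add: divide_le_eq)
    with t have "t + l < 1" by linarith
    have t0: "0 \<le> t" "t < 1" by (simp_all add: t_def frac_lt_1)
    \<comment> \<open>Otherwise \<open>y - t\<close> wraps around to
      \<open>y - t + 1 \<ge> 1 - t > l\<close>, outside the arc.\<close>
    have "t \<le> y"
    proof (rule ccontr)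
      assume "\<not> t \<le> y"
      hence "\<lfloor>y - t\<rfloor> = -1" using y t0 by (intro floor_unique) auto
      hence "frac (y - t) = y - t + 1" by (simp add: frac_def)
      with f y \<open>t + l < 1\<close> show False by linarith
    qed
    hence "frac (y - t) = y - t" using y t0 by (simp add: frac_eq)
    with f t \<open>t \<le> y\<close> show ?thesis unfolding y_def[symmetric] by linarith
  qed
  have "i = j" if "i < n" "j < n" "N + k i \<in> A" "N + k j \<in> A" for i j N
  proof -
    have "real i / real n < (real j + 1) / real n" "real j / real n < (real i + 1) / real n"
      using window[of i N] window[of j N] that by linarith+
    hence "real i < real j + 1" "real j < real i + 1"
      using \<open>n > 0\<close> by (simp_all add: divide_less_cancel)
    thus ?thesis by linarith
  qed
  hence "\<forall>M. n * card (A \<inter> {1..M}) \<le> M + (\<Sum>i<n. k i)"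
    using card_times_le_if_disjoint_translates[of n k A] by blast
  thus ?thesis unfolding A_def by blast
qed

text \<open>The interval is covered by \<open>K\<close> consecutive arcs of length
  \<open>1 / (n + 1)\<close>, each of frequency at most \<open>1 / n\<close> up to a bounded count.
  Since \<open>K / n\<close> is at most \<open>v - u + 2 / n\<close>, a large \<open>n\<close>
  suffices.\<close>

lemma h_seq_upper_density:
  assumes p: "p \<notin> \<rat>" and uv: "u \<le> v" "v - u \<le> 1" and e: "e > 0"
  shows "\<forall>\<^sub>F M in sequentially.
     real (card {N \<in> {1..M}. h_seq p N \<in> {u..<v}}) / real M < v - u + e"
proof -
  \<comment> \<open>With \<open>n > 4 / e\<close> the covering error \<open>2 / n\<close> is below
    \<open>e / 2\<close>; the other half of \<open>e\<close> absorbs \<open>D / M\<close>.\<close>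
  obtain n0 :: nat where n0: "4 / e < real n0" using reals_Archimedean2 by blast
  define n where "n = Suc n0"
  have n: "n > 0" "2 / real n < e / 2" using n0 e by (simp_all add: n_def field_simps)
  define l where "l = 1 / (real n + 1)"
  have l: "0 < l" "l \<le> 1" "l < 1 / real n" using n by (simp_all add: l_def field_simps)
  define K where "K = nat \<lceil>(v - u) * (real n + 1)\<rceil>"
  define A where "A = (\<lambda>j. {N. frac (- real N * p - (u + real j * l)) < l})"
  have "\<forall>j. \<exists>C. \<forall>M. n * card (A j \<inter> {1..M}) \<le> M + C"
    unfolding A_def using card_visits_short_arc[OF p n(1) l(3)] by blast
  then obtain C where C: "n * card (A j \<inter> {1..M}) \<le> M + C j" for j M by metis
  have cover: "{N \<in> {1..M}. h_seq p N \<in> {u..<v}} \<subseteq> (\<Union>j<K. A j \<inter> {1..M})" for M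
  proof
    fix N assume N: "N \<in> {N \<in> {1..M}. h_seq p N \<in> {u..<v}}"
    define x where "x = (h_seq p N - u) / l"
    define j where "j = nat \<lfloor>x\<rfloor>"
    have "x \<ge> 0" using N l by (simp add: x_def)
    hence j: "real j \<le> x" "x < real j + 1" by (simp_all add: j_def)
    have "x < (v - u) * (real n + 1)" using N unfolding x_def l_def by simp
    hence "real j < real_of_int \<lceil>(v - u) * (real n + 1)\<rceil>" using j by linarith
    hence "j < K" unfolding K_def by linarith
    have "h_seq p N - u = x * l" using l by (simp add: x_def)
    moreover have "real j * l \<le> x * l" "x * l < (real j + 1) * l" using j l by simp_all
    ultimately have "0 \<le> h_seq p N - (u + real j * l)" "h_seq p N - (u + real j * l) < l"
      by (simp_all add: algebra_simps)
    moreover from this have "frac (h_seq p N - (u + real j * l)) = h_seq p N - (u + real j * l)"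
      using l by (simp add: frac_eq)
    \<comment> \<open>Modulo 1, \<open>h_seq p\<close> is the orbit of the rotation by
      \<open>-p\<close>.\<close>
    moreover have "frac (h_seq p N - (u + real j * l)) = frac (- real N * p - (u + real j * l))"
    proof -
      have "h_seq p N - (u + real j * l) = - real N * p - (u + real j * l) + of_int \<lceil>real N * p\<rceil>"
        by (simp add: h_seq_def)
      thus ?thesis by (metis frac_add_of_int_right)
    qed
    ultimately have "N \<in> A j" by (simp add: A_def)
    with N \<open>j < K\<close> show "N \<in> (\<Union>j<K. A j \<inter> {1..M})" by blast
  qed
  define D where "D = real (\<Sum>j<K. C j) / real n"
  have bound: "real (card {N \<in> {1..M}. h_seq p N \<in> {u..<v}}) \<le> (v - u + e / 2) * real M + D" for M
  proof -
    have "card {N \<in> {1..M}. h_seq p N \<in> {u..<v}} \<le> card (\<Union>j<K. A j \<inter> {1..M})"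
      by (intro card_mono cover) auto
    also have "\<dots> \<le> (\<Sum>j<K. card (A j \<inter> {1..M}))" by (rule card_UN_le) simp
    finally have "n * card {N \<in> {1..M}. h_seq p N \<in> {u..<v}} \<le> (\<Sum>j<K. n * card (A j \<inter> {1..M}))"
      by (simp add: sum_distrib_left[symmetric])
    also have "\<dots> \<le> (\<Sum>j<K. M + C j)" by (intro sum_mono C)
    finally have "n * card {N \<in> {1..M}. h_seq p N \<in> {u..<v}} \<le> K * M + (\<Sum>j<K. C j)"
      by (simp add: sum.distrib)
    hence "real n * real (card {N \<in> {1..M}. h_seq p N \<in> {u..<v}})
        \<le> real K * real M + real (\<Sum>j<K. C j)"
      by (metis of_nat_add of_nat_le_iff of_nat_mult)
    hence "real (card {N \<in> {1..M}. h_seq p N \<in> {u..<v}}) \<le> real K / real n * real M + D"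
      using n(1) by (simp add: D_def field_simps)
    also have "real K / real n \<le> v - u + e / 2"
    proof -
      have "(v - u) * (real n + 1) \<ge> 0" using uv by simp
      hence "real K \<le> (v - u) * (real n + 1) + 1" unfolding K_def by linarith
      \<comment> \<open>One unit comes from the ceiling, the other from
        \<open>v - u \<le> 1\<close>.\<close>
      also have "\<dots> \<le> (v - u) * real n + 2" using uv by (simp add: algebra_simps)
      finally have "real K / real n \<le> ((v - u) * real n + 2) / real n"
        by (intro divide_right_mono) auto
      also have "\<dots> = v - u + 2 / real n" using n by (simp add: field_simps)
      finally show ?thesis using n by linarith
    qed
    finally show ?thesis by (simp add: mult_right_mono)
  qed
  have "(\<lambda>M. D / real M) \<longlonglongrightarrow> 0" by (rule lim_const_over_n)
  hence "\<forall>\<^sub>F M in sequentially. D / real M < e / 2" using e by (intro order_tendstoD) auto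
  moreover have "\<forall>\<^sub>F M :: nat in sequentially. M > 0" by (rule eventually_gt_at_top)
  ultimately show ?thesis
  proof eventually_elim
    case (elim M)
    have "real (card {N \<in> {1..M}. h_seq p N \<in> {u..<v}}) / real M
        \<le> ((v - u + e / 2) * real M + D) / real M"
      by (intro divide_right_mono bound) auto
    also have "\<dots> = v - u + e / 2 + D / real M" using elim by (simp add: add_divide_distrib)
    finally show ?case using elim by linarith
  qed
qed

text \<open>The upper density bounds for \<open>[u, v)\<close> and for its two complementary intervals suffice,
  since the three densities add up to 1.\<close>

lemma equidistributed01_h_seq:
  assumes p: "p \<notin> \<rat>"
  shows "equidistributed01 (h_seq p)"
  unfolding equidistributed01_def
proof (intro conjI allI impI)
  fix N show "h_seq p N \<in> {0..<1}" using h_seq_bounds by simp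
next
  fix u v :: real assume uv: "0 \<le> u \<and> u \<le> v \<and> v \<le> 1"
  define c where "c = (\<lambda>u v M. real (card {N \<in> {1..M}. h_seq p N \<in> {u..<v}}) / real M)"
  have upper: "\<forall>\<^sub>F M in sequentially. c u v M < v - u + e" if "u \<le> v" "v - u \<le> 1" "e > 0" for u v e
    unfolding c_def using h_seq_upper_density[OF p that] .
  have total: "c 0 u M + c u v M + c v 1 M = 1" if "M > 0" for M
  proof -
    define S where "S = (\<lambda>u v. {N \<in> {1..M}. h_seq p N \<in> {u..<v}})"
    have "{1..M} = S 0 u \<union> S u v \<union> S v 1"
      using h_seq_bounds[of p] by (auto simp: S_def not_le)
    hence "card {1..M} = card (S 0 u \<union> S u v \<union> S v 1)" by simp
    also have "\<dots> = card (S 0 u \<union> S u v) + card (S v 1)"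
      using uv by (intro card_Un_disjoint) (auto simp: S_def)
    also have "card (S 0 u \<union> S u v) = card (S 0 u) + card (S u v)"
      using uv by (intro card_Un_disjoint) (auto simp: S_def)
    finally have "real M = real (card (S 0 u)) + real (card (S u v)) + real (card (S v 1))" by simp
    with that show ?thesis unfolding c_def S_def
      by (simp add: add_divide_distrib[symmetric])
  qed
  have "(c u v) \<longlonglongrightarrow> v - u"
  proof (rule order_tendstoI)
    fix a assume a: "a > v - u"
    show "\<forall>\<^sub>F M in sequentially. c u v M < a" using upper[of u v "a - (v - u)"] a uv by simp
  next
    fix a assume a: "a < v - u"
    \<comment> \<open>The two complementary intervals may each exceed their length by
      \<open>e\<close>, using up the gap between \<open>a\<close> and \<open>v - u\<close>.\<close>
    define e where "e = (v - u - a) / 2"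
    have "e > 0" using a by (simp add: e_def)
    have "\<forall>\<^sub>F M in sequentially. c 0 u M < u + e" using upper[of 0 u e] \<open>e > 0\<close> uv by simp
    moreover have "\<forall>\<^sub>F M in sequentially. c v 1 M < 1 - v + e"
      using upper[of v 1 e] \<open>e > 0\<close> uv by simp
    moreover have "\<forall>\<^sub>F M :: nat in sequentially. M > 0" by (rule eventually_gt_at_top)
    ultimately show "\<forall>\<^sub>F M in sequentially. a < c u v M"
    proof eventually_elim
      case (elim M)
      have "a = v - u - 2 * e" by (simp add: e_def field_simps)
      with elim total[of M] show ?case by linarith
    qed
  qed
  thus "(\<lambda>M. real (card {N \<in> {1..M}. h_seq p N \<in> {u..<v}}) / real M) \<longlonglongrightarrow> v - u"
    by (simp add: c_def)
qed

section \<open>Means along an equidistributed sequence\<close>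

text \<open>Terms are grouped by the cell of width \<open>1 / n\<close> containing
  \<open>x N\<close>. Uniform continuity replaces \<open>f (x N)\<close> by the value at the left
  end point, and equidistribution gives each cell weight \<open>1 / n\<close>, which leaves a grid
  mean close to \<open>L\<close>.\<close>

lemma equidistributed01_mean_tendsto:
  fixes f :: "real \<Rightarrow> real"
  assumes x: "equidistributed01 x" and f: "continuous_on {0..1} f"
    and R: "(\<lambda>n. 1 / real n * (\<Sum>i<n. f (real i / real n))) \<longlonglongrightarrow> L"
  shows "(\<lambda>M. 1 / real M * (\<Sum>N = 1..M. f (x N))) \<longlonglongrightarrow> L"
proof (rule tendstoI)
  fix e :: real assume e: "e > 0"
  \<comment> \<open>Three errors of size at most \<open>r\<close> occur: from replacing values, from
    the cell frequencies, and from the grid mean.\<close>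
  define r where "r = e / 4"
  have r: "r > 0" using e by (simp add: r_def)
  have "uniformly_continuous_on {0..1} f" by (intro compact_uniformly_continuous f) simp
  then obtain d where d: "d > 0"
      "\<And>s t. s \<in> {0..1} \<Longrightarrow> t \<in> {0..1} \<Longrightarrow> dist s t < d \<Longrightarrow> dist (f s) (f t) < r"
    unfolding uniformly_continuous_on_def using r by metis
  have "\<forall>\<^sub>F n in sequentially. dist (1 / real n * (\<Sum>i<n. f (real i / real n))) L < r"
    using R r by (rule tendstoD)
  moreover have "\<forall>\<^sub>F n in sequentially. 1 / real n < d"
    using lim_const_over_n[of "1 :: real"] d(1) by (intro order_tendstoD) auto
  moreover have "\<forall>\<^sub>F n :: nat in sequentially. n > 0" by (rule eventually_gt_at_top)
  ultimately have "\<forall>\<^sub>F n in sequentially. dist (1 / real n * (\<Sum>i<n. f (real i / real n))) L < r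
      \<and> 1 / real n < d \<and> n > 0"
    by eventually_elim auto
  then obtain n where n: "dist (1 / real n * (\<Sum>i<n. f (real i / real n))) L < r"
      "1 / real n < d" "n > 0"
    by (metis (mono_tags, lifting) eventually_happens trivial_limit_sequentially)
  define S where "S = (\<lambda>M i. {N \<in> {1..M}. x N \<in> {real i / real n..<real (Suc i) / real n}})"
  \<comment> \<open>The orbit mean with each \<open>f (x N)\<close> replaced by the value of
    \<open>f\<close> at the left end of its cell.\<close>
  define g where "g = (\<lambda>M. \<Sum>i<n. real (card (S M i)) / real M * f (real i / real n))"
  have "g \<longlonglongrightarrow> (\<Sum>i<n. (real (Suc i) / real n - real i / real n) * f (real i / real n))"
    unfolding g_def S_def
  proof (intro tendsto_sum tendsto_mult tendsto_const)
    fix i assume "i \<in> {..<n}"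
    hence "0 \<le> real i / real n \<and> real i / real n \<le> real (Suc i) / real n \<and> real (Suc i) / real n \<le> 1"
      by (simp add: divide_le_eq divide_right_mono)
    thus "(\<lambda>M. real (card {N \<in> {1..M}. x N \<in> {real i / real n..<real (Suc i) / real n}}) / real M)
        \<longlonglongrightarrow> real (Suc i) / real n - real i / real n"
      using x unfolding equidistributed01_def by blast
  qed
  also have "(\<Sum>i<n. (real (Suc i) / real n - real i / real n) * f (real i / real n))
      = 1 / real n * (\<Sum>i<n. f (real i / real n))"
    by (simp add: diff_divide_distrib[symmetric] sum_distrib_left)
  finally have "\<forall>\<^sub>F M in sequentially. dist (g M) (1 / real n * (\<Sum>i<n. f (real i / real n))) < r"
    using r by (rule tendstoD)
  moreover have "\<forall>\<^sub>F M :: nat in sequentially. M > 0" by (rule eventually_gt_at_top)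
  ultimately show "\<forall>\<^sub>F M in sequentially. dist (1 / real M * (\<Sum>N = 1..M. f (x N))) L < e"
  proof eventually_elim
    case (elim M)
    have S_fin: "finite (S M i)" for i by (simp add: S_def)
    have UN: "(\<Union>i<n. S M i) = {1..M}"
    proof
      show "{1..M} \<subseteq> (\<Union>i<n. S M i)"
      proof
        fix N assume N: "N \<in> {1..M}"
        have xN: "0 \<le> x N" "x N < 1" using x N by (auto simp: equidistributed01_def)
        define i where "i = nat \<lfloor>x N * real n\<rfloor>"
        have i: "real i \<le> x N * real n" "x N * real n < real i + 1"
          using xN by (simp_all add: i_def)
        have "x N * real n < real n" using xN n by simp
        hence "i < n" using i by linarith
        moreover have "N \<in> S M i" using i N n by (simp add: S_def field_simps)
        ultimately show "N \<in> (\<Union>i<n. S M i)" by blast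
      qed
    qed (auto simp: S_def)
    have disj: "S M i \<inter> S M j = {}" if "i \<noteq> j" for i j
    proof (rule ccontr)
      assume "S M i \<inter> S M j \<noteq> {}"
      then obtain N where "N \<in> S M i" "N \<in> S M j" by blast
      hence "real i / real n < real (Suc j) / real n" "real j / real n < real (Suc i) / real n"
        by (auto simp: S_def)
      hence "i < Suc j" "j < Suc i"
        using n(3) by (simp_all add: divide_less_cancel)
      with that show False by simp
    qed
    have "(\<Sum>N = 1..M. f (x N)) = (\<Sum>i<n. \<Sum>N\<in>S M i. f (x N))"
      unfolding UN[symmetric] by (rule sum.UNION_disjoint) (use S_fin disj in auto)
    moreover have "real M * g M = (\<Sum>i<n. \<Sum>N\<in>S M i. f (real i / real n))"
      using elim by (simp add: g_def sum_distrib_left)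
    ultimately have "(\<Sum>N = 1..M. f (x N)) - real M * g M
        = (\<Sum>i<n. \<Sum>N\<in>S M i. f (x N) - f (real i / real n))"
      by (simp add: sum_subtractf)
    also have "\<bar>\<dots>\<bar> \<le> (\<Sum>i<n. \<Sum>N\<in>S M i. \<bar>f (x N) - f (real i / real n)\<bar>)"
      by (intro order.trans[OF sum_abs] sum_mono sum_abs)
    also have "\<dots> \<le> (\<Sum>i<n. \<Sum>N\<in>S M i. r)"
    proof (intro sum_mono)
      fix i N assume i: "i \<in> {..<n}" and N: "N \<in> S M i"
      have "real (Suc i) / real n = real i / real n + 1 / real n" by (simp add: add_divide_distrib)
      moreover have "real i / real n \<le> x N" "x N < real (Suc i) / real n" using N by (auto simp: S_def)
      ultimately have "\<bar>x N - real i / real n\<bar> < d" using n(2) by linarith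
      moreover have "x N \<in> {0..1}" using x N by (force simp: S_def equidistributed01_def)
      moreover have "real i / real n \<in> {0..1}" using i by (simp add: divide_le_eq)
      ultimately show "\<bar>f (x N) - f (real i / real n)\<bar> \<le> r"
        using d(2)[of "x N" "real i / real n"] by (simp add: dist_real_def)
    qed
    also have "\<dots> = (\<Sum>N = 1..M. r)"
      unfolding UN[symmetric] by (rule sum.UNION_disjoint[symmetric]) (use S_fin disj in auto)
    finally have "\<bar>(\<Sum>N = 1..M. f (x N)) - real M * g M\<bar> \<le> real M * r" by simp
    hence "\<bar>(\<Sum>N = 1..M. f (x N)) - real M * g M\<bar> / real M \<le> r"
      using elim by (simp add: field_simps)
    also have "\<bar>(\<Sum>N = 1..M. f (x N)) - real M * g M\<bar> / real M
        = \<bar>((\<Sum>N = 1..M. f (x N)) - real M * g M) / real M\<bar>" by simp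
    also have "((\<Sum>N = 1..M. f (x N)) - real M * g M) / real M
        = 1 / real M * (\<Sum>N = 1..M. f (x N)) - g M"
      using elim by (simp add: diff_divide_distrib)
    finally have "dist (1 / real M * (\<Sum>N = 1..M. f (x N))) (g M) \<le> r" by (simp add: dist_real_def)
    with elim n(1) r show ?case unfolding dist_real_def r_def by linarith
  qed
qed

section \<open>One period for rational \<open>p\<close>\<close>

lemma h_seq_add_period:
  assumes "p = real a / real b" "b > 0"
  shows "h_seq p (N + b) = h_seq p N"
proof -
  have "real (N + b) * p = real N * p + real_of_int (int a)"
    using assms by (simp add: field_simps)
  thus ?thesis unfolding h_seq_def by (simp del: of_int_of_nat_eq)
qed

text \<open>Equal values at \<open>x\<close> and \<open>y\<close> give \<open>b\<close> dividing
  \<open>(x - y) a\<close>, hence \<open>x - y\<close> by coprimality, and \<open>x - y\<close> is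
  smaller than \<open>b\<close> in absolute value. So \<open>b\<close> distinct values lie in a grid
  of \<open>b\<close> points and fill it.\<close>

lemma bij_betw_h_seq_period:
  assumes p: "p = real a / real b" and b: "b > 0" and cop: "coprime a b"
  shows "bij_betw (h_seq p) {n..<n + b} ((\<lambda>i. real i / real b) ` {..<b})"
proof -
  have "inj_on (h_seq p) {n..<n + b}"
  proof (rule inj_onI)
    fix x y assume xy: "x \<in> {n..<n + b}" "y \<in> {n..<n + b}" and eq: "h_seq p x = h_seq p y"
    have "real x * p - real y * p = of_int (\<lceil>real x * p\<rceil> - \<lceil>real y * p\<rceil>)"
      using eq by (simp add: h_seq_def)
    hence "real x * real a - real y * real a = of_int (\<lceil>real x * p\<rceil> - \<lceil>real y * p\<rceil>) * real b"
      using b unfolding p by (simp add: field_simps)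
    hence "real_of_int ((int x - int y) * int a)
        = real_of_int ((\<lceil>real x * p\<rceil> - \<lceil>real y * p\<rceil>) * int b)"
      by (simp add: left_diff_distrib)
    hence "(int x - int y) * int a = (\<lceil>real x * p\<rceil> - \<lceil>real y * p\<rceil>) * int b"
      by (simp only: of_int_eq_iff)
    hence "int b dvd (int x - int y) * int a" by simp
    moreover have "coprime (int b) (int a)" using cop by (simp add: coprime_commute)
    ultimately have "int b dvd int x - int y" by (simp add: coprime_dvd_mult_left_iff)
    moreover have "\<bar>int x - int y\<bar> < int b" using xy by auto
    ultimately have "int x - int y = 0" using dvd_imp_le_int[of "int x - int y" "int b"] by linarith
    thus "x = y" by simp
  qed
  moreover have "h_seq p ` {n..<n + b} = (\<lambda>i. real i / real b) ` {..<b}"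
  proof (rule card_subset_eq)
    show "h_seq p ` {n..<n + b} \<subseteq> (\<lambda>i. real i / real b) ` {..<b}"
    proof (rule image_subsetI)
      fix N
      \<comment> \<open>The integer \<open>b * h_seq p N\<close>, i.e. the numerator of the value
        over \<open>b\<close>.\<close>
      define z where "z = \<lceil>real N * p\<rceil> * int b - int N * int a"
      have h: "h_seq p N = real_of_int z / real b"
        using b by (simp add: h_seq_def z_def p field_simps)
      hence "0 \<le> real_of_int z / real b" "real_of_int z / real b < 1"
        using h_seq_bounds[of p N] by simp_all
      hence "0 \<le> real_of_int z" "real_of_int z < real b"
        using b by (simp_all add: field_simps zero_le_divide_iff)
      hence "0 \<le> z" "z < int b" by linarith+
      hence "h_seq p N = real (nat z) / real b" "nat z \<in> {..<b}" by (simp_all add: h nat_less_iff)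
      thus "h_seq p N \<in> (\<lambda>i. real i / real b) ` {..<b}" by blast
    qed
    have "inj_on (\<lambda>i. real i / real b) {..<b}" using b by (auto simp: inj_on_def)
    with \<open>inj_on (h_seq p) {n..<n + b}\<close>
    show "card (h_seq p ` {n..<n + b}) = card ((\<lambda>i. real i / real b) ` {..<b})"
      by (simp add: card_image)
  qed simp
  ultimately show ?thesis by (simp add: bij_betw_def)
qed

subsection \<open>Means of the coefficients\<close>

text \<open>Every term of the lattice part carries a factor \<open>1 / n^j\<close> with
  \<open>j \<ge> 2\<close>, so it dies out as the grid is refined.\<close>

lemma d_poly_grid_mean_tendsto:
  "(\<lambda>n. 1 / real n * (\<Sum>i<n. poly (d_poly p m) (real i / real n))) \<longlonglongrightarrow> smooth_part p m"
proof -
  define F where "F = (\<lambda>n :: nat. smooth_part p m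
      + (\<Sum>j = 2..2 * m. lattice_coeff p m j * (1 / real n ^ j) * bernoulli j))"
  have "(\<lambda>n. 1 / real n ^ j) \<longlonglongrightarrow> 0" if "j \<ge> 2" for j
  proof -
    have "(\<lambda>n. (1 / real n) ^ j) \<longlonglongrightarrow> 0 ^ j"
      by (intro tendsto_power lim_const_over_n)
    thus ?thesis using that by (simp add: power_divide power_0_left)
  qed
  hence "F \<longlonglongrightarrow> smooth_part p m
      + (\<Sum>j = 2..2 * m. lattice_coeff p m j * 0 * bernoulli j)"
    unfolding F_def
    by (intro tendsto_add tendsto_sum tendsto_mult tendsto_const) auto
  hence "F \<longlonglongrightarrow> smooth_part p m" by simp
  \<comment> \<open>The closed form is available only for \<open>n > 0\<close>, so agreement is
    eventual.\<close>
  moreover have "\<forall>\<^sub>F n in sequentially.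
      F n = 1 / real n * (\<Sum>i<n. poly (d_poly p m) (real i / real n))"
    using eventually_gt_at_top[of 0]
    by eventually_elim (simp only: F_def d_poly_grid_mean)
  ultimately show ?thesis by (rule Lim_transform_eventually)
qed

lemma d_poly_period_mean:
  assumes "p = real a / real b" "b > 0" "coprime a b"
  shows "1 / real b * (\<Sum>N\<in>{n..<n + b}. poly (d_poly p m) (h_seq p N))
     = smooth_part p m + (\<Sum>j = 2..2 * m. lattice_coeff p m j * (1 / real b ^ j) * bernoulli j)"
proof -
  have "inj_on (\<lambda>i. real i / real b) {..<b}" using assms by (auto simp: inj_on_def)
  hence "(\<Sum>x\<in>(\<lambda>i. real i / real b) ` {..<b}. poly (d_poly p m) x)
      = (\<Sum>i<b. poly (d_poly p m) (real i / real b))"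
    by (simp add: sum.reindex)
  thus ?thesis
    using sum.reindex_bij_betw[OF bij_betw_h_seq_period[OF assms], of "poly (d_poly p m)"]
      d_poly_grid_mean[OF assms(2)] by simp
qed

theorem proposition6p1:
  fixes p :: real
  assumes "0 < p" and "p < 1"
  shows
    "(\<forall>m h. poly (d_poly p m) h
          = smooth_part p m + (\<Sum>j = 2..2 * m. lattice_coeff p m j * poly (bernpoly j) h))
     \<and>
     (p \<notin> \<rat> \<longrightarrow>
        equidistributed01 (h_seq p) \<and>
        (\<forall>m. (\<lambda>M. 1 / real M * (\<Sum>N = 1..M. poly (d_poly p m) (h_seq p N)))
                \<longlonglongrightarrow> smooth_part p m))
     \<and>
     (\<forall>a b :: nat. coprime a b \<and> p = real a / real b \<longrightarrow>
        (\<forall>N\<ge>1. h_seq p (N + b) = h_seq p N) \<and>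
        (\<forall>n\<ge>1. bij_betw (h_seq p) {n..<n + b} ((\<lambda>i. real i / real b) ` {..<b})) \<and>
        (\<forall>m. \<forall>n\<ge>1. 1 / real b * (\<Sum>N\<in>{n..<n + b}. poly (d_poly p m) (h_seq p N))
            = smooth_part p m
              + (\<Sum>j = 2..2 * m. lattice_coeff p m j * (1 / real b ^ j) * bernoulli j)))"
proof (intro conjI impI allI)
  show "poly (d_poly p m) h
      = smooth_part p m + (\<Sum>j = 2..2 * m. lattice_coeff p m j * poly (bernpoly j) h)" for m h
    by (rule d_poly_decomposition)
next
  assume "p \<notin> \<rat>"
  thus "equidistributed01 (h_seq p)" by (rule equidistributed01_h_seq)
  thus "(\<lambda>M. 1 / real M * (\<Sum>N = 1..M. poly (d_poly p m) (h_seq p N))) \<longlonglongrightarrow> smooth_part p m" for m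
    by (rule equidistributed01_mean_tendsto)
       (intro continuous_intros, rule d_poly_grid_mean_tendsto)
next
  fix a b :: nat
  assume "coprime a b \<and> p = real a / real b"
  \<comment> \<open>For \<open>b = 0\<close> the quotient \<open>a / b\<close> would be 0,
    contradicting \<open>0 < p\<close>.\<close>
  moreover from this have "b > 0" using \<open>0 < p\<close> by (cases "b = 0") auto
  ultimately have ab: "p = real a / real b" "b > 0" "coprime a b" by auto
  show "h_seq p (N + b) = h_seq p N" for N by (rule h_seq_add_period[OF ab(1,2)])
  show "bij_betw (h_seq p) {n..<n + b} ((\<lambda>i. real i / real b) ` {..<b})" for n
    by (rule bij_betw_h_seq_period[OF ab])
  show "1 / real b * (\<Sum>N\<in>{n..<n + b}. poly (d_poly p m) (h_seq p N)) = smooth_part p m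
      + (\<Sum>j = 2..2 * m. lattice_coeff p m j * (1 / real b ^ j) * bernoulli j)" for m n
    by (rule d_poly_period_mean[OF ab])
qed

end
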